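(* Let $k$ be a positive integer, let $M(k)=\binom{k}{\lfloor k/2\rfloor}$, and let $\Delta^-,\Delta^+\geq -1$ be integers. (i) If $\Delta^-+\Delta^+\leq M(k)-2$, then $c(\Delta^-,\Delta^+)\leq k$. (ii) If $\max\{\Delta^-,\Delta^+\}> M(k)-1$, then $c(\Delta^-,\Delta^+)>k$. (iii) If $\Delta^-+\Delta^+> M(k+1)-2$, then $c(\Delta^-,\Delta^+)>k$.
   Context: A digraph $D=(V,A)$ (finite) is covered by $k$ cuts if there are $U_1,\dots,U_k\subseteq V$ such that every arc $uv\in A$ has some $a$ with $u\in U_a$, $v\notin U_a$; equivalently, there is a labeling $C:V\to\mathcal{P}(\{1,\dots,k\})$ with $C(u)\not\subseteq C(v)$ for every arc $uv$. For integers $\Delta^-,\Delta^+\geq -1$, $\mathcal{D}(\Delta^-,\Delta^+)$ is the class of all finite acyclic digraphs in which every vertex has indegree at most $\Delta^-$ or outdegree at most $\Delta^+$, and $c(\Delta^-,\Delta^+)$ is the smallest $k$ such that every digraph in $\mathcal{D}(\Delta^-,\Delta^+)$ is covered by $k$ cuts. *)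

theory Defs
  imports Graph_Theory.Pair_Digraph "HOL-Library.Extended_Nat"
begin

definition covered_by_cuts :: "'a pair_pre_digraph \<Rightarrow> nat \<Rightarrow> bool" where
  "covered_by_cuts D k \<longleftrightarrow>
     (\<exists>U :: nat \<Rightarrow> 'a set.
        (\<forall>i\<in>{1..k}. U i \<subseteq> pverts D) \<and>
        (\<forall>(u, v)\<in>parcs D. \<exists>i\<in>{1..k}. u \<in> U i \<and> v \<notin> U i))"

text \<open>
  The degree bounds are integers because the bound \<open>-1\<close>, which no vertex satisfies, is allowed.
\<close>

definition degree_class :: "int \<Rightarrow> int \<Rightarrow> 'a pair_pre_digraph set" where
  "degree_class dm dp =
     {D. pair_fin_digraph D \<and> acyclic (parcs D) \<and>
         (\<forall>v\<in>pverts D. int (in_degree (with_proj D) v) \<le> dm \<or>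
                        int (out_degree (with_proj D) v) \<le> dp)}"

text \<open>
  Every finite digraph is isomorphic to one whose vertices are natural numbers, so letting \<open>D\<close>
  range over digraphs on \<open>nat\<close> loses nothing; see \<open>covered_if_cut_number_le\<close> below.
  The infimum in \<open>enat\<close> is the smallest such \<open>k\<close>, and \<open>\<infinity>\<close> if there is none.
\<close>

definition cut_number :: "int \<Rightarrow> int \<Rightarrow> enat" where
  "cut_number dm dp =
     Inf {enat k | k. \<forall>D :: nat pair_pre_digraph.
                        D \<in> degree_class dm dp \<longrightarrow> covered_by_cuts D k}"

lemma covered_by_cuts_mono:
  assumes "covered_by_cuts D k" "k \<le> l"
  shows "covered_by_cuts D l"
proof -
  obtain U where U: "\<forall>i\<in>{1..k}. U i \<subseteq> pverts D"
    "\<forall>(u, v)\<in>parcs D. \<exists>i\<in>{1..k}. u \<in> U i \<and> v \<notin> U i"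
    using assms(1) unfolding covered_by_cuts_def by blast
  show ?thesis
    unfolding covered_by_cuts_def
  proof (intro exI conjI ballI)
    show "(if i \<le> k then U i else {}) \<subseteq> pverts D" if "i \<in> {1..l}" for i
      using U(1) that by auto
    show "case e of (u, v) \<Rightarrow> \<exists>i\<in>{1..l}. u \<in> (if i \<le> k then U i else {}) \<and>
            v \<notin> (if i \<le> k then U i else {})" if e: "e \<in> parcs D" for e
    proof (cases e)
      case (Pair u v)
      then obtain i where "i \<in> {1..k}" "u \<in> U i" "v \<notin> U i"
        using U(2) e by blast
      then show ?thesis using Pair assms(2) by (auto intro!: bexI[of _ i])
    qed
  qed
qed

lemma covered_if_cut_number_le:
  fixes D :: "'a pair_pre_digraph"
  assumes le: "cut_number dm dp \<le> enat k" and D: "D \<in> degree_class dm dp"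
  shows "covered_by_cuts D k"
proof -
  interpret D: pair_fin_digraph D using D by (simp add: degree_class_def)
  obtain f :: "'a \<Rightarrow> nat" where f: "inj_on f (pverts D)"
    using D.pair_finite_verts finite_imp_inj_to_nat_seg by blast
  define g where "g = map_prod f f"
  define E where "E = \<lparr>pverts = f ` pverts D, parcs = g ` parcs D\<rparr>"
  have sub: "parcs D \<subseteq> pverts D \<times> pverts D"
    by (auto dest: D.in_arcsD1 D.in_arcsD2)
  have g: "inj_on g (parcs D)"
    unfolding g_def using map_prod_inj_on[OF f f] sub by (rule inj_on_subset)
  have fin: "pair_fin_digraph E"
    by unfold_locales
      (auto simp: E_def g_def D.pair_finite_verts D.pair_finite_arcs dest: D.in_arcsD1 D.in_arcsD2)
  have walk: "\<exists>a b. x = f a \<and> y = f b \<and> a \<in> pverts D \<and> b \<in> pverts D \<and> (a, b) \<in> (parcs D)\<^sup>+"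
    if "(x, y) \<in> (g ` parcs D)\<^sup>+" for x y
    using that
  proof (induction rule: trancl_induct)
    case (base y)
    then show ?case by (auto simp: g_def dest: D.in_arcsD1 D.in_arcsD2)
  next
    case (step y z)
    obtain a b where ab: "x = f a" "y = f b" "a \<in> pverts D" "b \<in> pverts D" "(a, b) \<in> (parcs D)\<^sup>+"
      using step.IH by blast
    obtain b' c where bc: "y = f b'" "z = f c" "(b', c) \<in> parcs D"
      using step.hyps(2) by (auto simp: g_def)
    have "b' \<in> pverts D" "c \<in> pverts D"
      using bc(3) sub by auto
    moreover from this have "b = b'"
      using f ab(2,4) bc(1) by (auto dest: inj_onD)
    ultimately show ?case
      using ab bc by (blast intro: trancl_into_trancl)
  qed
  have acyc: "acyclic (parcs E)"
    unfolding acyclic_def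
  proof (intro allI notI)
    fix x assume "(x, x) \<in> (parcs E)\<^sup>+"
    then obtain a b where "f a = f b" "a \<in> pverts D" "b \<in> pverts D" "(a, b) \<in> (parcs D)\<^sup>+"
      using walk[of x x] by (auto simp: E_def)
    then have "(a, a) \<in> (parcs D)\<^sup>+" using f by (auto dest: inj_onD)
    then show False using D by (auto simp: degree_class_def acyclic_def)
  qed
  have deg: "in_degree (with_proj E) (f v) = in_degree (with_proj D) v"
            "out_degree (with_proj E) (f v) = out_degree (with_proj D) v"
    if v: "v \<in> pverts D" for v
  proof -
    have "in_arcs (with_proj E) (f v) = g ` in_arcs (with_proj D) v"
      using f v sub by (fastforce simp: in_arcs_def E_def g_def dest: inj_onD)
    then show "in_degree (with_proj E) (f v) = in_degree (with_proj D) v"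
      unfolding in_degree_def by (auto intro!: card_image inj_on_subset[OF g])
    have "out_arcs (with_proj E) (f v) = g ` out_arcs (with_proj D) v"
      using f v sub by (fastforce simp: out_arcs_def E_def g_def dest: inj_onD)
    then show "out_degree (with_proj E) (f v) = out_degree (with_proj D) v"
      unfolding out_degree_def by (auto intro!: card_image inj_on_subset[OF g])
  qed
  have "E \<in> degree_class dm dp"
    using D fin acyc deg by (auto simp: degree_class_def E_def)
  moreover obtain l where l: "l \<le> k"
    "\<forall>D :: nat pair_pre_digraph. D \<in> degree_class dm dp \<longrightarrow> covered_by_cuts D l"
  proof -
    let ?S = "{enat k | k. \<forall>D :: nat pair_pre_digraph.
                        D \<in> degree_class dm dp \<longrightarrow> covered_by_cuts D k}"
    have "Inf ?S < enat (Suc k)"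
      using le unfolding cut_number_def by (rule le_less_trans) simp
    then obtain n where "n \<in> ?S" "n < enat (Suc k)"
      unfolding Inf_less_iff by blast
    then show thesis using that by (auto simp: less_Suc_eq_le)
  qed
  ultimately have "covered_by_cuts E k" using covered_by_cuts_mono by blast
  then obtain U where U: "\<forall>(u, v)\<in>parcs E. \<exists>i\<in>{1..k}. u \<in> U i \<and> v \<notin> U i"
    unfolding covered_by_cuts_def by blast
  show ?thesis
    unfolding covered_by_cuts_def
  proof (intro exI conjI ballI)
    show "{v \<in> pverts D. f v \<in> U i} \<subseteq> pverts D" for i by blast
    show "case e of (u, v) \<Rightarrow> \<exists>i\<in>{1..k}. u \<in> {v \<in> pverts D. f v \<in> U i} \<and>
            v \<notin> {v \<in> pverts D. f v \<in> U i}" if "e \<in> parcs D" for e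
      using that U sub by (fastforce simp: E_def g_def)
  qed
qed

end

theory Submission
  imports Defs "HOL-Library.Nat_Bijection"
begin

text \<open>
  (i) Greedy colouring along the acyclic order colours the vertices of indegree at most
  \<open>\<Delta>\<^sup>-\<close> with \<open>\<Delta>\<^sup>- + 1\<close> colours and the remaining ones with \<open>\<Delta>\<^sup>+ + 1\<close> further colours; as
  colours, take subsets of \<open>{1..k}\<close> in the middle layer, which are pairwise incomparable.

  (ii), (iii) Starting from the empty set, repeatedly add, for every set of at most \<open>\<Delta>\<^sup>-\<close> old
  vertices, a new vertex with this in-neighbourhood. In a labelling by subsets of \<open>{1..k}\<close>, from
  some step on no new labels appear. A new vertex dominated by representatives of the minimal
  labels would then get a new label, so there are at least \<open>\<Delta>\<^sup>- + 1\<close> minimal labels. The reversed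
  construction gives at least \<open>\<Delta>\<^sup>+ + 1\<close> maximal labels. Joining the first digraph completely
  to the second stays within the class and forces no minimal label of the first to be contained
  in a maximal label of the second. Adding the element \<open>k + 1\<close> to the latter yields an antichain
  in the subsets of \<open>{1..k + 1}\<close>, and Sperner's theorem bounds its size.
\<close>

section \<open>Sperner's theorem\<close>

definition antichain :: "'a set set \<Rightarrow> bool" where
  "antichain F \<longleftrightarrow> (\<forall>A\<in>F. \<forall>B\<in>F. A \<subseteq> B \<longrightarrow> A = B)"

lemma antichainI: "(\<And>A B. A \<in> F \<Longrightarrow> B \<in> F \<Longrightarrow> A \<subseteq> B \<Longrightarrow> A = B) \<Longrightarrow> antichain F"
  by (simp add: antichain_def)

lemma antichainD: "antichain F \<Longrightarrow> A \<in> F \<Longrightarrow> B \<in> F \<Longrightarrow> A \<subseteq> B \<Longrightarrow> A = B"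
  by (simp add: antichain_def)

lemma antichain_subset: "antichain F \<Longrightarrow> G \<subseteq> F \<Longrightarrow> antichain G"
  by (auto simp: antichain_def)

text \<open>A set of size \<open>a\<close> misses \<open>n - a\<close> of the \<open>n\<close>
  points; its LYM weights in the ground sets with one missed point deleted add up to
  \<open>n\<close> times its own weight.\<close>

lemma inverse_binomial_pred:
  assumes "a < n"
  shows "real (n - a) / real ((n - 1) choose a) = real n / real (n choose a)"
proof -
  have "(n - a) * (n choose a) = n * ((n - 1) choose a)"
    using binomial_absorb_comp[of n a] by simp
  then have "real (n - a) * real (n choose a) = real n * real ((n - 1) choose a)"
    by (metis of_nat_mult)
  moreover have "(n choose a) > 0" "((n - 1) choose a) > 0"
    using assms by (simp_all add: zero_less_binomial_iff)
  ultimately show ?thesis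
    by (simp add: field_simps)
qed

text \<open>
  Induction on the ground set: summing the inequality for the members of \<open>F\<close> that avoid \<open>x\<close> over
  all \<open>x \<in> S\<close> gives \<open>n\<close> times the inequality for \<open>F\<close>.
\<close>

lemma LYM_inequality:
  assumes "finite S" "F \<subseteq> Pow S" "antichain F"
  shows "(\<Sum>A\<in>F. 1 / real (card S choose card A)) \<le> 1"
  using assms
proof (induction "card S" arbitrary: S F rule: less_induct)
  case less
  let ?n = "card S"
  have finF: "finite F"
    using less.prems finite_subset[of F "Pow S"] by simp
  show ?case
  \<comment> \<open>The full set avoids no point, so the averaging would not count it; in an
    antichain it is the only member.\<close>
  proof (cases "S \<in> F")
    case True
    then have "F = {S}"
      using less.prems(2) antichainD[OF less.prems(3)] by blast
    then show ?thesis by simp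
  next
    case False
    have small: "card A < ?n" if "A \<in> F" for A
      using that False less.prems by (metis PowD psubsetI psubset_card_mono subsetD)
    show ?thesis
    proof (cases "S = {}")
      case True
      then have "F = {}" using False less.prems by auto
      then show ?thesis by simp
    next
      case nonempty: False
      then have npos: "?n > 0" using less.prems by (simp add: card_gt_0_iff)
      have IH: "(\<Sum>A\<in>{A\<in>F. x \<notin> A}. 1 / real ((?n - 1) choose card A)) \<le> 1" if x: "x \<in> S" for x
      proof -
        have c: "card (S - {x}) = ?n - 1" using x less.prems by simp
        have "(\<Sum>A\<in>{A\<in>F. x \<notin> A}. 1 / real (card (S - {x}) choose card A)) \<le> 1"
        proof (rule less.hyps)
          show "card (S - {x}) < ?n" using c npos by simp
          show "antichain {A \<in> F. x \<notin> A}"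
            using less.prems(3) by (rule antichain_subset) auto
        qed (use less.prems in auto)
        then show ?thesis unfolding c .
      qed
      have "real ?n * (\<Sum>A\<in>F. 1 / real (?n choose card A))
          = (\<Sum>A\<in>F. real (?n - card A) / real ((?n - 1) choose card A))"
        unfolding sum_distrib_left
      proof (rule sum.cong[OF refl])
        fix A assume "A \<in> F"
        then show "real ?n * (1 / real (?n choose card A))
            = real (?n - card A) / real ((?n - 1) choose card A)"
          using inverse_binomial_pred[OF small] by simp
      qed
      also have "\<dots> = (\<Sum>A\<in>F. \<Sum>x\<in>S. if x \<notin> A then 1 / real ((?n - 1) choose card A) else 0)"
      proof (rule sum.cong[OF refl])
        fix A assume "A \<in> F"
        then have "A \<subseteq> S" using less.prems by auto
        then have "card {x\<in>S. x \<notin> A} = ?n - card A"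
          using less.prems(1) by (simp add: card_Diff_subset finite_subset set_diff_eq[symmetric])
        then show "real (?n - card A) / real ((?n - 1) choose card A)
          = (\<Sum>x\<in>S. if x \<notin> A then 1 / real ((?n - 1) choose card A) else 0)"
          using less.prems(1) by (simp flip: sum.inter_filter)
      qed
      also have "\<dots> = (\<Sum>x\<in>S. \<Sum>A\<in>{A\<in>F. x \<notin> A}. 1 / real ((?n - 1) choose card A))"
        using finF by (subst sum.swap) (simp only: sum.inter_filter)
      also have "\<dots> \<le> (\<Sum>x\<in>S. 1)"
        by (intro sum_mono IH)
      finally show ?thesis using npos by simp
    qed
  qed
qed

text \<open>The middle binomial coefficient is the largest, so every member contributes at least its
  reciprocal to the LYM sum.\<close>

theorem Sperner:
  assumes "finite S" "F \<subseteq> Pow S" "antichain F"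
  shows "card F \<le> card S choose (card S div 2)"
proof -
  let ?M = "card S choose (card S div 2)"
  have Mpos: "?M > 0" by (simp add: zero_less_binomial_iff)
  have "real (card F) / real ?M = (\<Sum>A\<in>F. 1 / real ?M)"
    by simp
  also have "\<dots> \<le> (\<Sum>A\<in>F. 1 / real (card S choose card A))"
  proof (intro sum_mono divide_left_mono)
    fix A assume "A \<in> F"
    then have "card A \<le> card S" using assms by (auto intro: card_mono)
    then show "0 < real ?M * real (card S choose card A)"
      using Mpos by (simp add: zero_less_binomial_iff)
    show "real (card S choose card A) \<le> real ?M"
      by (simp add: binomial_maximum)
  qed simp
  also have "\<dots> \<le> 1" using LYM_inequality assms by blast
  finally show ?thesis using Mpos by (simp add: field_simps)
qed

text \<open>A set tagged with \<open>k + 1\<close> cannot lie in an untagged one, and an untagged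
  \<open>a\<close> inside a tagged \<open>b\<close> would give \<open>a \<subseteq> b\<close>, which
  \<open>cross\<close> excludes.\<close>

lemma cross_antichains_card_le:
  assumes A: "A \<subseteq> Pow {1..k}" "antichain A" and B: "B \<subseteq> Pow {1..k}" "antichain B"
    and cross: "\<And>a b. a \<in> A \<Longrightarrow> b \<in> B \<Longrightarrow> \<not> a \<subseteq> b"
  shows "card A + card B \<le> (k + 1) choose ((k + 1) div 2)"
proof -
  let ?B = "insert (k + 1) ` B"
  have new: "k + 1 \<notin> a" if "a \<in> A \<union> B" for a
    using that A(1) B(1) by fastforce
  have inj: "inj_on (insert (k + 1)) B"
    using new by (auto intro!: inj_onI simp: insert_ident)
  have fin: "finite A" "finite B"
    using A(1) B(1) by (auto intro: finite_subset)
  have "A \<inter> ?B = {}"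
    using new by auto
  then have "card A + card B = card (A \<union> ?B)"
    using fin inj by (simp add: card_Un_disjoint card_image)
  also have "\<dots> \<le> card {1..k + 1} choose (card {1..k + 1} div 2)"
  proof (rule Sperner)
    have "a \<subseteq> {1..k + 1}" if "a \<in> A \<union> B" for a
      using that A(1) B(1) by fastforce
    then show "A \<union> ?B \<subseteq> Pow {1..k + 1}" by auto
    have "\<not> a \<subseteq> insert (k + 1) b" if "a \<in> A" "b \<in> B" for a b
      using cross[OF that] new[of a] that by blast
    moreover have "\<not> insert (k + 1) b \<subseteq> a" if "a \<in> A" "b \<in> B" for a b
      using new[of a] that by blast
    moreover have "a = b" if "a \<in> B" "b \<in> B" "insert (k + 1) a \<subseteq> insert (k + 1) b" for a b
    proof -
      have "a \<subseteq> b" using new[of a] that by blast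
      then show ?thesis using antichainD[OF B(2)] that by blast
    qed
    ultimately show "antichain (A \<union> ?B)"
      by (intro antichainI) (elim UnE imageE; blast dest: antichainD[OF A(2)])
  qed simp
  finally show ?thesis by simp
qed

section \<open>Cut coverings as labellings\<close>

text \<open>The label of a vertex collects the indices of the cuts containing it.\<close>

lemma covered_by_cutsD:
  assumes "covered_by_cuts D k"
  obtains C where "\<And>v. C v \<subseteq> {1..k}" "\<And>u v. (u, v) \<in> parcs D \<Longrightarrow> \<not> C u \<subseteq> C v"
proof -
  obtain U where U: "\<forall>(u, v)\<in>parcs D. \<exists>i\<in>{1..k}. u \<in> U i \<and> v \<notin> U i"
    using assms unfolding covered_by_cuts_def by blast
  show thesis
    by (rule that[of "\<lambda>v. {i\<in>{1..k}. v \<in> U i}"]) (use U in blast)+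
qed

lemma covered_by_cutsI:
  assumes "pair_wf_digraph D"
    and "\<And>v. v \<in> pverts D \<Longrightarrow> C v \<subseteq> {1..k}" "\<And>u v. (u, v) \<in> parcs D \<Longrightarrow> \<not> C u \<subseteq> C v"
  shows "covered_by_cuts D k"
  unfolding covered_by_cuts_def
proof (intro exI conjI ballI)
  show "{v \<in> pverts D. i \<in> C v} \<subseteq> pverts D" for i by blast
  show "case e of (u, v) \<Rightarrow>
      \<exists>i\<in>{1..k}. u \<in> {v \<in> pverts D. i \<in> C v} \<and> v \<notin> {v \<in> pverts D. i \<in> C v}"
    if e: "e \<in> parcs D" for e
  proof (cases e)
    case (Pair u v)
    then have "u \<in> pverts D" "\<not> C u \<subseteq> C v"
      using e assms(1,3) by (auto dest: pair_wf_digraph.in_arcsD1)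
    then show ?thesis using Pair assms(2) by blast
  qed
qed

lemma in_degree_with_proj: "in_degree (with_proj D) v = card {u. (u, v) \<in> parcs D}"
proof -
  have "in_arcs (with_proj D) v = (\<lambda>u. (u, v)) ` {u. (u, v) \<in> parcs D}"
    by (auto simp: in_arcs_def)
  then show ?thesis by (simp add: in_degree_def card_image inj_on_def)
qed

lemma out_degree_with_proj: "out_degree (with_proj D) v = card {w. (v, w) \<in> parcs D}"
proof -
  have "out_arcs (with_proj D) v = (\<lambda>w. (v, w)) ` {w. (v, w) \<in> parcs D}"
    by (auto simp: out_arcs_def)
  then show ?thesis by (simp add: out_degree_def card_image inj_on_def)
qed

section \<open>The upper bound\<close>

text \<open>Remove a sink of the digraph induced on \<open>V\<close> and colour the rest; only the
  in-neighbours of the sink restrict its colour, and they are fewer than the colours.\<close>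

lemma greedy_colouring:
  assumes "finite V" "finite r" "acyclic r"
    and "\<And>v. v \<in> V \<Longrightarrow> card {u\<in>V. (u, v) \<in> r} < card K"
  obtains f where "f ` V \<subseteq> K" "\<And>u v. u \<in> V \<Longrightarrow> v \<in> V \<Longrightarrow> (u, v) \<in> r \<Longrightarrow> f u \<noteq> f v"
proof -
  have "\<exists>f. f ` V \<subseteq> K \<and> (\<forall>u\<in>V. \<forall>v\<in>V. (u, v) \<in> r \<longrightarrow> f u \<noteq> f v)"
    using assms(1,4)
  proof (induction "card V" arbitrary: V)
    case 0
    then show ?case by simp
  next
    case (Suc n)
    then obtain x where "x \<in> V" by fastforce
    moreover have "wf (r\<inverse>)"
      using assms by (simp add: finite_acyclic_wf_converse)
    ultimately obtain s where s: "s \<in> V" "\<And>w. (s, w) \<in> r \<Longrightarrow> w \<notin> V"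
      unfolding wf_eq_minimal by (metis converse_iff)
    let ?N = "{u\<in>V. (u, s) \<in> r}"
    have "n = card (V - {s})" using Suc.hyps s Suc.prems by simp
    moreover have "card {u\<in>V - {s}. (u, v) \<in> r} < card K" if "v \<in> V - {s}" for v
    proof -
      have "card {u\<in>V - {s}. (u, v) \<in> r} \<le> card {u\<in>V. (u, v) \<in> r}"
        using Suc.prems(1) by (intro card_mono) auto
      also have "\<dots> < card K" using Suc.prems(2) that by blast
      finally show ?thesis .
    qed
    ultimately obtain f where f: "f ` (V - {s}) \<subseteq> K"
      "\<forall>u\<in>V - {s}. \<forall>v\<in>V - {s}. (u, v) \<in> r \<longrightarrow> f u \<noteq> f v"
      using Suc.hyps(1)[of "V - {s}"] Suc.prems(1) by blast
    have finN: "finite ?N" using Suc.prems(1) by simp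
    have "card (f ` ?N) \<le> card ?N" using finN by (rule card_image_le)
    also have "\<dots> < card K" using Suc.prems(2) s(1) .
    finally have "\<not> K \<subseteq> f ` ?N"
      using card_mono[OF finite_imageI[OF finN, of f], of K] by auto
    then obtain c where c: "c \<in> K" "c \<notin> f ` ?N" by blast
    show ?case
    proof (intro exI[of _ "f(s := c)"] conjI)
      show "(f(s := c)) ` V \<subseteq> K" using f c by auto
      show "\<forall>u\<in>V. \<forall>v\<in>V. (u, v) \<in> r \<longrightarrow> (f(s := c)) u \<noteq> (f(s := c)) v"
        using f(2) c s by auto
    qed
  qed
  then obtain f where "f ` V \<subseteq> K" "\<forall>u\<in>V. \<forall>v\<in>V. (u, v) \<in> r \<longrightarrow> f u \<noteq> f v"
    by (elim exE conjE)
  then show thesis by (intro that[of f]) simp_all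
qed

lemma degree_class_labelling:
  assumes D: "D \<in> degree_class dm dp"
    and K: "finite K" "dm \<ge> -1" "dp \<ge> -1" "dm + dp + 2 \<le> int (card K)"
  obtains f where "f ` pverts D \<subseteq> K" "\<And>u v. (u, v) \<in> parcs D \<Longrightarrow> f u \<noteq> f v"
proof -
  interpret D: pair_fin_digraph D using D by (simp add: degree_class_def)
  define r where "r = parcs D"
  define V where "V = {v\<in>pverts D. int (in_degree (with_proj D) v) \<le> dm}"
  define W where "W = pverts D - V"
  have r: "finite r" "acyclic r" and fin: "finite V" "finite W"
    using D D.pair_finite_arcs D.pair_finite_verts by (auto simp: r_def V_def W_def degree_class_def)
  have fins: "finite {u. (u, v) \<in> r}" "finite {u. (v, u) \<in> r}" for v
    using finite_subset[of "{u. (u, v) \<in> r}" "fst ` r"] finite_subset[of "{u. (v, u) \<in> r}" "snd ` r"] r(1)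
    by force+
  \<comment> \<open>Two disjoint palettes, so arcs between \<open>V\<close> and \<open>W\<close>
    cause no conflict. Each has one colour more than the degree bound; for the bound -1 it is
    empty.\<close>
  have "nat (dm + 1) \<le> card K" using K by linarith
  then obtain K1 where K1: "K1 \<subseteq> K" "card K1 = nat (dm + 1)"
    by (metis obtain_subset_with_card_n)
  have "nat (dp + 1) \<le> card (K - K1)"
    using K K1 by (simp add: card_Diff_subset finite_subset)
  then obtain K2 where K2: "K2 \<subseteq> K - K1" "card K2 = nat (dp + 1)"
    by (metis obtain_subset_with_card_n)
  have inV: "card {u\<in>V. (u, v) \<in> r} < card K1" if "v \<in> V" for v
  proof -
    have "card {u\<in>V. (u, v) \<in> r} \<le> in_degree (with_proj D) v"
      unfolding in_degree_with_proj r_def[symmetric] using fins by (intro card_mono) auto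
    then show ?thesis using that K1 by (auto simp: V_def)
  qed
  obtain f where f: "f ` V \<subseteq> K1" "\<And>u v. u \<in> V \<Longrightarrow> v \<in> V \<Longrightarrow> (u, v) \<in> r \<Longrightarrow> f u \<noteq> f v"
    using greedy_colouring[OF fin(1) r inV] by metis
  \<comment> \<open>On \<open>W\<close> the outdegree is bounded, so the greedy colouring runs on
    the reversed arcs.\<close>
  have outW: "card {u\<in>W. (u, v) \<in> r\<inverse>} < card K2" if "v \<in> W" for v
  proof -
    have "card {u\<in>W. (u, v) \<in> r\<inverse>} \<le> out_degree (with_proj D) v"
      unfolding out_degree_with_proj r_def[symmetric] using fins by (intro card_mono) auto
    moreover have "int (out_degree (with_proj D) v) \<le> dp"
      using that D by (auto simp: W_def V_def degree_class_def)
    ultimately show ?thesis using K2 by linarith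
  qed
  obtain g where g: "g ` W \<subseteq> K2" "\<And>u v. u \<in> W \<Longrightarrow> v \<in> W \<Longrightarrow> (u, v) \<in> r\<inverse> \<Longrightarrow> g u \<noteq> g v"
  proof (rule greedy_colouring[of W "r\<inverse>" K2])
    show "finite (r\<inverse>)" "acyclic (r\<inverse>)" using r by (simp_all add: acyclic_converse)
  qed (use fin outW in auto)
  have VW: "pverts D = V \<union> W" "V \<inter> W = {}" by (auto simp: V_def W_def)
  show thesis
  proof (rule that[of "\<lambda>v. if v \<in> V then f v else g v"])
    show "(\<lambda>v. if v \<in> V then f v else g v) ` pverts D \<subseteq> K"
      using f(1) g(1) K1 K2 VW by auto
    fix u v assume uv: "(u, v) \<in> parcs D"
    then have "u \<in> V \<union> W" "v \<in> V \<union> W"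
      using VW D.in_arcsD1 D.in_arcsD2 by auto
    moreover have "f x \<noteq> g y" if "x \<in> V" "y \<in> W" for x y
      using that f(1) g(1) K2 by blast
    moreover have "g x \<noteq> f y" if "x \<in> W" "y \<in> V" for x y
      using that f(1) g(1) K2 by blast
    ultimately show "(if u \<in> V then f u else g u) \<noteq> (if v \<in> V then f v else g v)"
      using f(2)[of u v] g(2)[of v u] uv by (auto simp: r_def)
  qed
qed

lemma cut_number_le:
  assumes "dm \<ge> -1" "dp \<ge> -1" "dm + dp \<le> int (k choose (k div 2)) - 2"
  shows "cut_number dm dp \<le> enat k"
proof -
  let ?K = "{A. A \<subseteq> {1..k} \<and> card A = k div 2}"
  have card: "card ?K = k choose (k div 2)"
    using n_subsets[of "{1..k}" "k div 2"] by simp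
  have "covered_by_cuts D k" if D: "D \<in> degree_class dm dp" for D :: "nat pair_pre_digraph"
  proof -
    have "finite ?K" by simp
    then obtain f where f: "f ` pverts D \<subseteq> ?K" "\<And>u v. (u, v) \<in> parcs D \<Longrightarrow> f u \<noteq> f v"
      using degree_class_labelling[OF D, of ?K] card assms by auto
    interpret D: pair_fin_digraph D using D by (simp add: degree_class_def)
    show ?thesis
    proof (rule covered_by_cutsI)
      show "pair_wf_digraph D" ..
      show "f v \<subseteq> {1..k}" if "v \<in> pverts D" for v
        using f(1) that by auto
      fix u v assume uv: "(u, v) \<in> parcs D"
      then have "f u \<in> ?K" "f v \<in> ?K"
        using f(1) D.in_arcsD1 D.in_arcsD2 by blast+
      \<comment> \<open>Nested sets of equal finite size coincide, so different labels are
        incomparable.\<close>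
      then show "\<not> f u \<subseteq> f v"
        using f(2)[OF uv] by (metis (mono_tags, lifting) card_subset_eq finite_atLeastAtMost
            finite_subset mem_Collect_eq)
    qed
  qed
  then show ?thesis
    unfolding cut_number_def by (intro Inf_lower) blast
qed

section \<open>The lower bounds\<close>

text \<open>
  A natural number \<open>n\<close> stands for the vertex whose in-neighbourhood is the set \<open>set_decode n\<close> of
  positions of ones in its binary expansion, so the numbers below \<open>2 ^ N\<close> are the subsets of
  those below \<open>N\<close>.
\<close>

definition code_verts :: "int \<Rightarrow> nat \<Rightarrow> nat set" where
  "code_verts p N = {n. n < N \<and> int (card (set_decode n)) \<le> p}"

text \<open>Subsets of the numbers below \<open>tower i\<close> have codes below
  \<open>tower (Suc i)\<close>: one level is one round of adding vertices, starting from
  none.\<close>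

definition tower :: "nat \<Rightarrow> nat" where
  "tower i = ((\<lambda>n. 2 ^ n) ^^ i) 0"

lemma tower_Suc: "tower (Suc i) = 2 ^ tower i"
  by (simp add: tower_def)

lemma tower_mono: "i \<le> j \<Longrightarrow> tower i \<le> tower j"
  by (rule lift_Suc_mono_le[of tower]) (simp_all add: tower_Suc less_imp_le)

lemma finite_code_verts [simp]: "finite (code_verts p N)"
  by (rule finite_subset[of _ "{..<N}"]) (auto simp: code_verts_def)

lemma code_verts_mono: "N \<le> N' \<Longrightarrow> code_verts p N \<subseteq> code_verts p N'"
  by (auto simp: code_verts_def)

lemma set_encode_less:
  assumes "S \<subseteq> {..<N}"
  shows "set_encode S < 2 ^ N"
proof -
  have "set_encode S \<le> (\<Sum>i<N. 2 ^ i)"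
    unfolding set_encode_def using assms by (intro sum_mono2) auto
  also have "\<dots> < 2 ^ N"
    by (induction N) auto
  finally show ?thesis .
qed

lemma set_decode_less: "m \<in> set_decode n \<Longrightarrow> m < n"
proof -
  assume "m \<in> set_decode n"
  then have "2 ^ m \<le> n"
    using member_le_sum[of m "set_decode n" "\<lambda>i. 2 ^ i :: nat"]
    by (simp flip: set_encode_def)
  then show ?thesis
    using less_exp[of m] by linarith
qed

text \<open>Each strict step adds an element, so strict growth at every index up to
  \<open>card L\<close> would produce more than \<open>card L\<close> elements.\<close>

lemma chain_stabilises:
  fixes F :: "nat \<Rightarrow> 'a set"
  assumes "finite L" "\<And>i. F i \<subseteq> L" "\<And>i. F i \<subseteq> F (Suc i)"
  obtains i where "i \<le> card L" "F (Suc i) = F i"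
proof (rule ccontr)
  note stable = that
  assume contra: "\<not> thesis"
  have strict: "F i \<subset> F (Suc i)" if "i \<le> card L" for i
    using assms(3)[of i] stable[OF that] contra by blast
  have "i \<le> card (F i)" if "i \<le> Suc (card L)" for i
    using that
  proof (induction i)
    case (Suc i)
    have "card (F i) < card (F (Suc i))"
      using Suc.prems strict[of i] finite_subset[OF assms(2,1)] by (intro psubset_card_mono) auto
    then show ?case using Suc by simp
  qed simp
  from this[of "Suc (card L)"] show False
    using card_mono[OF assms(1) assms(2)[of "Suc (card L)"]] by simp
qed

lemma antichain_of_labels:
  fixes c :: "nat \<Rightarrow> 'a set"
  assumes L: "finite L" "range c \<subseteq> L" and p: "p \<ge> -1"
    and arcs: "\<And>m n. m \<in> V \<Longrightarrow> n \<in> V \<Longrightarrow> m \<in> set_decode n \<Longrightarrow> \<not> c m \<subseteq> c n"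
    and V: "V = code_verts p (tower (Suc (card L)))"
  obtains A where "A \<subseteq> c ` V" "antichain A" "int (card A) \<ge> p + 1"
proof -
  define F where "F i = c ` code_verts p (tower i)" for i
  obtain i where i: "i \<le> card L" "F (Suc i) = F i"
  proof (rule chain_stabilises[of L F])
    show "F i \<subseteq> F (Suc i)" for i
      unfolding F_def by (intro image_mono code_verts_mono tower_mono) simp
  qed (use L in \<open>auto simp: F_def\<close>)
  \<comment> \<open>The new vertex lives one level above the stable level
    \<open>i \<le> card L\<close>, hence the height \<open>Suc (card L)\<close>.\<close>
  have sub: "code_verts p (tower i) \<subseteq> V" "code_verts p (tower (Suc i)) \<subseteq> V"
    unfolding V using i(1) by (auto intro!: code_verts_mono tower_mono)
  define A where "A = {a \<in> F i. \<forall>b\<in>F i. b \<subseteq> a \<longrightarrow> a = b}"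
  have finF: "finite (F i)" by (simp add: F_def)
  have "int (card A) \<ge> p + 1"
  proof (rule ccontr)
    assume "\<not> int (card A) \<ge> p + 1"
    have "A \<subseteq> c ` code_verts p (tower i)" by (auto simp: A_def F_def)
    \<comment> \<open>One representative per minimal label: \<open>card S = card A \<le> p\<close>,
      so the code of \<open>S\<close> is an admissible vertex.\<close>
    then obtain S where S: "S \<subseteq> code_verts p (tower i)" "inj_on c S" "A = c ` S"
      by (metis subset_image_inj)
    have fin: "finite S" using S(1) by (rule finite_subset) simp
    let ?n = "set_encode S"
    have "?n < tower (Suc i)"
      unfolding tower_Suc using S(1) by (intro set_encode_less) (auto simp: code_verts_def)
    moreover have "int (card S) \<le> p"
      using \<open>\<not> int (card A) \<ge> p + 1\<close> S by (simp add: card_image)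
    ultimately have n: "?n \<in> code_verts p (tower (Suc i))"
      using fin by (simp add: code_verts_def)
    \<comment> \<open>By stability the label of the new vertex is old, so it contains a minimal
      label, whose representative has an arc to the new vertex.\<close>
    then have "c ?n \<in> F i" using i(2) by (auto simp: F_def)
    from finite_has_minimal2[OF finF this] obtain a where "a \<in> A" "a \<subseteq> c ?n"
      unfolding A_def by blast
    then obtain m where "m \<in> S" "c m \<subseteq> c ?n" using S(3) by auto
    then show False
      using arcs[of m ?n] S(1) n sub fin by auto
  qed
  moreover have "antichain A" by (auto simp: A_def antichain_def)
  moreover have "A \<subseteq> c ` V" using sub(1) by (auto simp: A_def F_def)
  ultimately show thesis using that by blast
qed

definition code_digraph :: "int \<Rightarrow> int \<Rightarrow> nat \<Rightarrow> (nat + nat) pair_pre_digraph" where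
  "code_digraph p q N =
     \<lparr>pverts = code_verts p N <+> code_verts q N,
      parcs = {(Inl m, Inl n) |m n. m \<in> code_verts p N \<and> n \<in> code_verts p N \<and> m \<in> set_decode n}
        \<union> {(Inr n, Inr m) |m n. m \<in> code_verts q N \<and> n \<in> code_verts q N \<and> m \<in> set_decode n}
        \<union> Inl ` code_verts p N \<times> Inr ` code_verts q N\<rparr>"

text \<open>The joining arcs leave the left copy and enter the right one, so they affect neither the
  indegrees on the left nor the outdegrees on the right.\<close>

lemma code_digraph_in_degree_class: "code_digraph p q N \<in> degree_class p q"
proof -
  let ?D = "code_digraph p q N"
  have sub: "parcs ?D \<subseteq> pverts ?D \<times> pverts ?D" and fin: "finite (pverts ?D)"
    by (auto simp: code_digraph_def)
  then have "finite (parcs ?D)"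
    by (meson finite_SigmaI finite_subset)
  then have "pair_fin_digraph ?D"
    using sub fin by unfold_locales auto
  moreover have "acyclic (parcs ?D)"
  proof (rule acyclic_subset[OF wf_acyclic])
    \<comment> \<open>This height increases along arcs: codes are below \<open>N\<close>, so left
      heights are below \<open>N\<close>, right heights above it, and the right order is
      reversed.\<close>
    let ?h = "\<lambda>v. case v of Inl n \<Rightarrow> n | Inr n \<Rightarrow> 2 * N - n"
    show "wf (measure ?h)" by simp
    show "parcs ?D \<subseteq> measure ?h"
      by (auto simp: code_digraph_def code_verts_def dest: set_decode_less)
  qed
  moreover have "int (in_degree (with_proj ?D) v) \<le> p \<or> int (out_degree (with_proj ?D) v) \<le> q"
    if "v \<in> pverts ?D" for v
  proof (cases v)
    case (Inl n)
    then have "int (card (set_decode n)) \<le> p"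
      using that by (auto simp: code_digraph_def code_verts_def)
    moreover have "card {u. (u, v) \<in> parcs ?D} \<le> card (Inl ` set_decode n :: (nat + nat) set)"
      using Inl by (intro card_mono) (auto simp: code_digraph_def)
    ultimately show ?thesis
      by (simp add: in_degree_with_proj card_image)
  next
    case (Inr n)
    then have "int (card (set_decode n)) \<le> q"
      using that by (auto simp: code_digraph_def code_verts_def)
    moreover have "card {u. (v, u) \<in> parcs ?D} \<le> card (Inr ` set_decode n :: (nat + nat) set)"
      using Inr by (intro card_mono) (auto simp: code_digraph_def)
    ultimately show ?thesis
      by (simp add: out_degree_with_proj card_image)
  qed
  ultimately show ?thesis by (simp add: degree_class_def)
qed

lemma antichains_if_cut_number_le:
  assumes p: "p \<ge> -1" and q: "q \<ge> -1" and le: "cut_number p q \<le> enat k"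
  obtains A B where "A \<subseteq> Pow {1..k}" "antichain A" "int (card A) \<ge> p + 1"
    "B \<subseteq> Pow {1..k}" "antichain B" "int (card B) \<ge> q + 1"
    "\<And>a b. a \<in> A \<Longrightarrow> b \<in> B \<Longrightarrow> \<not> a \<subseteq> b"
proof -
  let ?L = "Pow {1..k}"
  define N where "N = tower (Suc (card ?L))"
  \<comment> \<open>The transfer to arbitrary vertex types is needed, as the vertices lie in a sum
    type.\<close>
  have "covered_by_cuts (code_digraph p q N) k"
    using covered_if_cut_number_le[OF le code_digraph_in_degree_class] .
  then obtain C where C: "\<And>v. C v \<subseteq> {1..k}"
      "\<And>u v. (u, v) \<in> parcs (code_digraph p q N) \<Longrightarrow> \<not> C u \<subseteq> C v"
    using covered_by_cutsD by metis
  \<comment> \<open>Complements undo the reversal of arcs on the right, so the same lemma serves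
    both copies; complementing \<open>B\<close> again restores the labels.\<close>
  let ?c = "\<lambda>n. C (Inl n)" and ?d = "\<lambda>n. {1..k} - C (Inr n)"
  obtain A where A: "A \<subseteq> ?c ` code_verts p N" "antichain A" "int (card A) \<ge> p + 1"
  proof (rule antichain_of_labels[of ?L ?c p "code_verts p N"])
    show "\<not> C (Inl m) \<subseteq> C (Inl n)"
      if "m \<in> code_verts p N" "n \<in> code_verts p N" "m \<in> set_decode n" for m n
      using that by (intro C(2)) (simp add: code_digraph_def)
  qed (use C(1) p N_def in auto)
  obtain B where B: "B \<subseteq> ?d ` code_verts q N" "antichain B" "int (card B) \<ge> q + 1"
  proof (rule antichain_of_labels[of ?L ?d q "code_verts q N"])
    show "\<not> {1..k} - C (Inr m) \<subseteq> {1..k} - C (Inr n)"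
      if "m \<in> code_verts q N" "n \<in> code_verts q N" "m \<in> set_decode n" for m n
    proof -
      have "\<not> C (Inr n) \<subseteq> C (Inr m)"
        using that by (intro C(2)) (simp add: code_digraph_def)
      then show ?thesis using C(1)[of "Inr n"] by blast
    qed
  qed (use q N_def in auto)
  have B': "b \<subseteq> {1..k}" if "b \<in> B" for b
    using B(1) that by auto
  show thesis
  proof (rule that[of A "(-) {1..k} ` B"])
    show "A \<subseteq> Pow {1..k}" using A(1) C(1) by blast
    show "antichain ((-) {1..k} ` B)"
    proof (intro antichainI, elim imageE)
      fix X Y x y
      assume *: "X \<subseteq> Y" "X = {1..k} - x" "x \<in> B" "Y = {1..k} - y" "y \<in> B"
      then have "y \<subseteq> x" using B'[of y] by blast
      then show "X = Y" using antichainD[OF B(2)] * by blast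
    qed
    have "inj_on ((-) {1..k}) B"
    proof (rule inj_onI)
      fix x y
      assume "x \<in> B" "y \<in> B" "{1..k} - x = {1..k} - y"
      then show "x = y" using B'[of x] B'[of y] by blast
    qed
    then show "int (card ((-) {1..k} ` B)) \<ge> q + 1"
      using B(3) by (simp add: card_image)
    fix a b assume "a \<in> A" "b \<in> (-) {1..k} ` B"
    then obtain m n where mn: "m \<in> code_verts p N" "a = C (Inl m)" "n \<in> code_verts q N"
        "b = {1..k} - ({1..k} - C (Inr n))"
      using A(1) B(1) by blast
    then have "b = C (Inr n)" using C(1)[of "Inr n"] by blast
    moreover have "\<not> C (Inl m) \<subseteq> C (Inr n)"
      using mn by (intro C(2)) (simp add: code_digraph_def)
    ultimately show "\<not> a \<subseteq> b" using mn by simp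
  qed (use A B in auto)
qed

theorem theorem2p1:
  fixes k :: nat and dm dp :: int
  assumes "k > 0" and "dm \<ge> -1" and "dp \<ge> -1"
  shows "(dm + dp \<le> int (k choose (k div 2)) - 2 \<longrightarrow> cut_number dm dp \<le> enat k) \<and>
         (max dm dp > int (k choose (k div 2)) - 1 \<longrightarrow> cut_number dm dp > enat k) \<and>
         (dm + dp > int ((k + 1) choose ((k + 1) div 2)) - 2 \<longrightarrow> cut_number dm dp > enat k)"
proof -
  \<comment> \<open>Contrapositive of (ii) and (iii): Sperner for each antichain gives the first
    bound, the joint estimate the second.\<close>
  have "max dm dp \<le> int (k choose (k div 2)) - 1 \<and>
      dm + dp \<le> int ((k + 1) choose ((k + 1) div 2)) - 2"
    if le: "cut_number dm dp \<le> enat k"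
  proof -
    obtain A B where A: "A \<subseteq> Pow {1..k}" "antichain A" "int (card A) \<ge> dm + 1"
      and B: "B \<subseteq> Pow {1..k}" "antichain B" "int (card B) \<ge> dp + 1"
      and cross: "\<And>a b. a \<in> A \<Longrightarrow> b \<in> B \<Longrightarrow> \<not> a \<subseteq> b"
      using antichains_if_cut_number_le[OF assms(2,3) le] by metis
    have "card A \<le> k choose (k div 2)" "card B \<le> k choose (k div 2)"
      using Sperner[of "{1..k}"] A B by auto
    moreover have "card A + card B \<le> (k + 1) choose ((k + 1) div 2)"
      using cross_antichains_card_le A(1,2) B(1,2) cross by blast
    ultimately show ?thesis using A(3) B(3) by linarith
  qed
  then show ?thesis
    using cut_number_le[OF assms(2,3)] by (meson linorder_not_le)
qed

end
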